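(* Let $\lambda$ be a nonzero real number and let $n$ be a nonnegative integer. Then $$F_{n,\lambda}^{(1-\lambda)}(x)=\sum_{k=0}^{n}\langle 1-\lambda\rangle_{k}{n \brace k}_{\lambda}x^{k}.$$
   Context: Fix a nonzero real $\lambda$. All generating functions are formal power series, with $(1+u)^{a}=\sum_{j\ge0}\binom{a}{j}u^{j}$. Notation: $(x)_{0,\lambda}=1$ and $(x)_{n,\lambda}=x(x-\lambda)\cdots(x-(n-1)\lambda)$ for $n\ge1$; $(x)_0=1$ and $(x)_n=x(x-1)\cdots(x-n+1)$ for $n\ge 1$; $\langle\alpha\rangle_0=1$ and $\langle\alpha\rangle_k=\alpha(\alpha+1)\cdots(\alpha+k-1)$ for $k\ge1$. Degenerate exponential: $e_{\lambda}(t)=(1+\lambda t)^{1/\lambda}=\sum_{n\ge0}(1)_{n,\lambda}\frac{t^{n}}{n!}$. Degenerate Stirling numbers of the second kind ${n\brace k}_{\lambda}$: defined by $(x)_{n,\lambda}=\sum_{k=0}^{n}{n \brace k}_{\lambda}(x)_{k}$, $n\ge0$. For $\alpha\in\mathbb{R}$, the degenerate Fubini polynomials of order $\alpha$, $F_{n,\lambda}^{(\alpha)}(x)$, are defined by $$\bigg(\frac{1}{1-x(e_{\lambda}(t)-1)}\bigg)^{\alpha}=\sum_{n=0}^{\infty}F_{n,\lambda}^{(\alpha)}(x)\frac{t^{n}}{n!}.$$ *)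

theory Defs
  imports Complex_Main "HOL-Computational_Algebra.Formal_Power_Series"
begin

definition falling :: "real \<Rightarrow> nat \<Rightarrow> real" where
  "falling x n = (\<Prod>i<n. x - real i)"

definition deg_falling :: "real \<Rightarrow> real \<Rightarrow> nat \<Rightarrow> real" where
  "deg_falling lam x n = (\<Prod>i<n. x - real i * lam)"

(* The binomial series f^a = (1 + u)^a = (\<Sum>j. (a gchoose j) u^j) with u = f - 1.
   Meaningful only if f has constant coefficient 1. *)
definition fps_rpow :: "real fps \<Rightarrow> real \<Rightarrow> real fps" where
  "fps_rpow f a = fps_binomial a oo (f - 1)"

definition deg_exp :: "real \<Rightarrow> real fps" where
  "deg_exp lam = fps_rpow (1 + fps_const lam * fps_X) (1 / lam)"

definition is_deg_stirling_row :: "real \<Rightarrow> nat \<Rightarrow> (nat \<Rightarrow> real) \<Rightarrow> bool" where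
  "is_deg_stirling_row lam n c \<longleftrightarrow>
     (\<forall>x. deg_falling lam x n = (\<Sum>k\<le>n. c k * falling x k)) \<and> (\<forall>k>n. c k = 0)"

definition deg_stirling2 :: "real \<Rightarrow> nat \<Rightarrow> nat \<Rightarrow> real" where
  "deg_stirling2 lam n = (THE c. is_deg_stirling_row lam n c)"

(* The formal power series is in t; x is a real value of the polynomial variable. *)
definition deg_fubini :: "real \<Rightarrow> real \<Rightarrow> nat \<Rightarrow> real \<Rightarrow> real" where
  "deg_fubini lam \<alpha> n x =
     fact n * fps_nth (fps_rpow (inverse (1 - fps_const x * (deg_exp lam - 1))) \<alpha>) n"

lemma falling_eq_0: "m < k \<Longrightarrow> falling (real m) k = 0"
  unfolding falling_def by (rule prod_zero) auto

lemma falling_diag_nz: "falling (real m) m \<noteq> 0"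
  unfolding falling_def by auto

lemma is_deg_stirling_row_exists: "\<exists>c. is_deg_stirling_row lam n c"
proof (induction n)
  case 0
  show ?case
    by (rule exI[of _ "\<lambda>k. if k = 0 then 1 else 0"])
       (simp add: is_deg_stirling_row_def deg_falling_def falling_def)
next
  case (Suc n)
  then obtain c where c: "\<And>x. deg_falling lam x n = (\<Sum>k\<le>n. c k * falling x k)"
    and z: "\<And>k. k > n \<Longrightarrow> c k = 0"
    unfolding is_deg_stirling_row_def by blast
  define d where "d k = (if k = 0 then 0 else c (k - 1)) + (real k - real n * lam) * c k" for k
  have "deg_falling lam x (Suc n) = (\<Sum>k\<le>Suc n. d k * falling x k)" for x
  proof -
    have S: "falling x (Suc k) = falling x k * (x - real k)" for k
      by (simp add: falling_def)
    have "deg_falling lam x (Suc n) = (\<Sum>k\<le>n. c k * falling x k) * (x - real n * lam)"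
      using c[of x] by (simp add: deg_falling_def)
    also have "\<dots> = (\<Sum>k\<le>n. c k * falling x (Suc k)) +
        (\<Sum>k\<le>n. (real k - real n * lam) * c k * falling x k)"
      unfolding sum_distrib_right sum.distrib[symmetric]
      by (rule sum.cong) (auto simp: S algebra_simps)
    also have "(\<Sum>k\<le>n. c k * falling x (Suc k)) =
        (\<Sum>k\<le>Suc n. (if k = 0 then 0 else c (k - 1)) * falling x k)"
      by (subst sum.atMost_Suc_shift) simp
    also have "(\<Sum>k\<le>n. (real k - real n * lam) * c k * falling x k) =
        (\<Sum>k\<le>Suc n. (real k - real n * lam) * c k * falling x k)"
      using z[of "Suc n"] by simp
    finally show ?thesis
      unfolding d_def by (simp only: sum.distrib[symmetric] distrib_right)
  qed
  moreover have "d k = 0" if "k > Suc n" for k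
    using that z[of k] z[of "k - 1"] by (simp add: d_def)
  ultimately show ?case
    unfolding is_deg_stirling_row_def by blast
qed

lemma is_deg_stirling_row_unique:
  assumes "is_deg_stirling_row lam n c" "is_deg_stirling_row lam n d"
  shows "c = d"
proof
  fix k
  show "c k = d k"
  proof (induction k rule: less_induct)
    case (less m)
    show ?case
    proof (cases "m \<le> n")
      case True
      have "(\<Sum>k\<le>n. (c k - d k) * falling (real m) k) = 0"
        using assms unfolding is_deg_stirling_row_def
        by (simp add: left_diff_distrib sum_subtractf)
      moreover have "(\<Sum>k\<le>n. (c k - d k) * falling (real m) k) =
          (\<Sum>k\<in>{m}. (c k - d k) * falling (real m) k)"
        by (rule sum.mono_neutral_right)
           (use True less.IH falling_eq_0 in \<open>auto simp: neq_iff\<close>)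
      ultimately show ?thesis using falling_diag_nz[of m] by simp
    qed (use assms in \<open>auto simp: is_deg_stirling_row_def\<close>)
  qed
qed

lemma is_deg_stirling_row_deg_stirling2: "is_deg_stirling_row lam n (deg_stirling2 lam n)"
  unfolding deg_stirling2_def
  using is_deg_stirling_row_exists is_deg_stirling_row_unique by (metis theI)

end

theory Submission
  imports Defs
begin

text \<open>
  Put \<open>w = e\<^sub>\<lambda>(t) - 1\<close>, a series without constant term. The generating function of the
  Fubini polynomials is the negative binomial series
  \<open>(1 - x u)\<^sup>-\<^sup>\<alpha> = (\<Sum>k. \<langle>\<alpha>\<rangle>\<^sub>k x\<^sup>k u\<^sup>k / k!)\<close> evaluated at \<open>u = w\<close>, so everything
  rests on the coefficients of the powers \<open>w\<^sup>k\<close>. These are the degenerate Stirling numbers: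
  \<open>w\<^sup>k / k!\<close> is the exponential generating function of the \<open>k\<close>-th column. To see this, expand
  \<open>(1 + w)\<^sup>y\<close> in two ways. By the binomial series it is \<open>(\<Sum>k. (y)\<^sub>k w\<^sup>k / k!)\<close>, and it
  equals \<open>(1 + \<lambda> t)\<^bsup>y/\<lambda>\<^esup>\<close>, the exponential generating function of the degenerate
  falling factorials of \<open>y\<close>. Comparing coefficients of \<open>t\<^sup>n\<close> gives an expansion of these in ordinary falling
  factorials for every \<open>y\<close>, and such an expansion is unique (lemma \<open>deg_stirling2_egf\<close>).
  The formula holds in this way for every order \<open>\<alpha>\<close> (lemma \<open>deg_fubini_eq_sum\<close>).

  Real powers of series are compositions with the binomial series, for which power laws such as
  \<open>(f\<^sup>a)\<^sup>b = f\<^bsup>ab\<^esup>\<close> or \<open>(1/f)\<^sup>a = f\<^sup>-\<^sup>a\<close> are not immediate. Differential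
  equations take their place: the logarithmic derivative of a power (\<open>fps_rpow_log_deriv\<close>) shows
  that both \<open>(1 + w)\<^sup>y\<close> and \<open>(1/(1 - x t))\<^sup>\<alpha>\<close> satisfy a first order equation \<open>(1 + c t) h' = b h\<close>, and this
  equation determines the coefficients (\<open>fps_nth_of_linear_ODE\<close>).
\<close>

lemma fps_rpow_nth_0: "fps_nth (fps_rpow f a) 0 = 1"
  by (simp add: fps_rpow_def)

text \<open>
  The rule \<open>(f\<^sup>a)' = a f\<^bsup>a-1\<^esup> f'\<close>, multiplied by \<open>f\<close> so that only the exponent \<open>a\<close>
  occurs. It is the equation \<open>(1 + u) B' = a B\<close> of the binomial series with \<open>u = f - 1\<close>
  substituted, combined with the chain rule.
\<close>

lemma fps_rpow_log_deriv:
  assumes "fps_nth f 0 = 1"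
  shows "f * fps_deriv (fps_rpow f a) = fps_const a * fps_rpow f a * fps_deriv f"
proof -
  have g0: "fps_nth (f - 1) 0 = 0"
    using assms by simp
  have "(1 + fps_X) * fps_deriv (fps_binomial a) = fps_const a * fps_binomial a"
    by (simp add: fps_binomial_deriv fps_divide_unit mult.left_commute inverse_mult_eq_1')
  then have "((1 + fps_X) * fps_deriv (fps_binomial a)) oo (f - 1)
      = (fps_const a * fps_binomial a) oo (f - 1)"
    by simp
  then have "f * (fps_deriv (fps_binomial a) oo (f - 1)) = fps_const a * fps_rpow f a"
    using g0 by (simp add: fps_compose_mult_distrib fps_compose_add_distrib fps_rpow_def)
  then show ?thesis
    using fps_compose_deriv[OF g0, of "fps_binomial a"]
    by (simp add: fps_rpow_def mult.assoc[symmetric])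
qed

text \<open>
  The solution is \<open>(1 + c t)\<^bsup>b/c\<^esup>\<close>. The equation amounts to the recurrence
  \<open>(n + 1) h\<^sub>n\<^sub>+\<^sub>1 = (b - n c) h\<^sub>n\<close>, which covers \<open>c = 0\<close> (where \<open>h = exp (b t)\<close>) as well.
\<close>

lemma fps_nth_of_linear_ODE:
  assumes ode: "(1 + fps_const c * fps_X) * fps_deriv h = fps_const b * h"
    and "fps_nth h 0 = 1"
  shows "fps_nth h n = deg_falling c b n / fact n"
proof (induction n)
  case 0
  show ?case
    using assms(2) by (simp add: deg_falling_def)
next
  case (Suc n)
  have "fps_nth ((1 + fps_const c * fps_X) * fps_deriv h) n = b * fps_nth h n"
    by (simp add: ode)
  then have "real (Suc n) * fps_nth h (Suc n) = (b - real n * c) * fps_nth h n"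
    by (cases n) (simp_all add: algebra_simps)
  then have "fps_nth h (Suc n) = (b - real n * c) * fps_nth h n / real (Suc n)"
    by (simp add: field_simps)
  then show ?case
    by (simp add: Suc.IH deg_falling_def mult_ac)
qed

text \<open>
  The negative binomial series. The equation of \<open>fps_nth_of_linear_ODE\<close> holds with \<open>c = -x\<close> and
  \<open>b = a x\<close>, so the factors \<open>b - i c = (a + i) x\<close> build up a rising factorial.
\<close>

lemma fps_rpow_geometric_nth:
  "fps_nth (fps_rpow (inverse (1 - fps_const x * fps_X)) a) n
     = pochhammer a n * x ^ n / fact n"
proof -
  define p :: "real fps" where "p = 1 - fps_const x * fps_X"
  define h where "h = fps_rpow (inverse p) a"
  have pf: "p * inverse p = 1"
    by (rule inverse_mult_eq_1') (simp add: p_def)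
  have "fps_deriv (p * inverse p) = 0"
    by (simp add: pf)
  then have df: "p * fps_deriv (inverse p) = fps_const x * inverse p"
    by (simp add: p_def algebra_simps)
  have "inverse p * fps_deriv h = fps_const a * h * fps_deriv (inverse p)"
    unfolding h_def by (rule fps_rpow_log_deriv) (simp add: p_def)
  \<comment> \<open>The derivative of \<open>1/p\<close> is \<open>x/p\<^sup>2\<close>; multiplying by \<open>p\<^sup>2\<close> clears all inverses.\<close>
  then have "p * p * (inverse p * fps_deriv h) = p * p * (fps_const a * h * fps_deriv (inverse p))"
    by simp
  then have "p * (p * inverse p) * fps_deriv h
      = fps_const a * h * (p * (p * fps_deriv (inverse p)))"
    by (simp only: mult_ac)
  also have "p * (p * fps_deriv (inverse p)) = fps_const x * (p * inverse p)"
    by (simp only: df mult.left_commute)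
  finally have "(1 + fps_const (- x) * fps_X) * fps_deriv h = fps_const (a * x) * h"
    unfolding pf
    by (simp add: p_def mult_ac flip: fps_const_mult fps_const_neg)
  then have "fps_nth h n = deg_falling (- x) (a * x) n / fact n"
    by (rule fps_nth_of_linear_ODE) (simp add: h_def fps_rpow_nth_0)
  moreover have "deg_falling (- x) (a * x) n = (\<Prod>i<n. (a + real i) * x)"
    by (simp add: deg_falling_def algebra_simps)
  ultimately show ?thesis
    by (simp add: h_def p_def pochhammer_prod prod.distrib atLeast0LessThan)
qed

lemma deg_exp_nth_0: "fps_nth (deg_exp lam) 0 = 1"
  by (simp add: deg_exp_def fps_rpow_nth_0)

lemma deg_exp_deriv:
  assumes "lam \<noteq> 0"
  shows "(1 + fps_const lam * fps_X) * fps_deriv (deg_exp lam) = deg_exp lam"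
  using fps_rpow_log_deriv[of "1 + fps_const lam * fps_X" "1 / lam"] assms
  by (simp add: deg_exp_def mult_ac)

text \<open>
  This is \<open>e\<^sub>\<lambda>(t)\<^sup>y = (1 + \<lambda> t)\<^bsup>y/\<lambda>\<^esup>\<close>: raising to the power \<open>y\<close> multiplies the
  logarithmic derivative \<open>1/(1 + \<lambda> t)\<close> of \<open>e\<^sub>\<lambda>\<close> by \<open>y\<close>.
\<close>

lemma fps_rpow_deg_exp_nth:
  assumes "lam \<noteq> 0"
  shows "fps_nth (fps_rpow (deg_exp lam) y) n = deg_falling lam y n / fact n"
proof (rule fps_nth_of_linear_ODE)
  let ?E = "deg_exp lam" and ?h = "fps_rpow (deg_exp lam) y" and ?l = "1 + fps_const lam * fps_X"
  have "?l * (?E * fps_deriv ?h) = ?l * (fps_const y * ?h * fps_deriv ?E)"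
    using fps_rpow_log_deriv[OF deg_exp_nth_0] by simp
  then have "?E * (?l * fps_deriv ?h) = fps_const y * ?h * (?l * fps_deriv ?E)"
    by (simp only: mult_ac)
  then have "?E * (?l * fps_deriv ?h) = ?E * (fps_const y * ?h)"
    unfolding deg_exp_deriv[OF assms] by (simp only: mult_ac)
  moreover have "?E \<noteq> 0"
    using deg_exp_nth_0[of lam] by auto
  ultimately show "?l * fps_deriv ?h = fps_const y * ?h"
    by simp
qed (simp add: fps_rpow_nth_0)

lemma gchoose_eq_falling: "y gchoose k = falling y k / fact k"
  by (simp add: gbinomial_prod_rev falling_def atLeast0LessThan)

text \<open>
  With \<open>w = e\<^sub>\<lambda>(t) - 1\<close>, the \<open>n\<close>-th coefficients of \<open>w\<^sup>k / k!\<close>, scaled by \<open>n!\<close>, expand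
  the degenerate falling factorial of every \<open>y\<close>, because \<open>e\<^sub>\<lambda>(t)\<^sup>y\<close> is the binomial series in \<open>w\<close>. Uniqueness of
  this expansion identifies them with the Stirling numbers.
\<close>

lemma deg_stirling2_egf:
  assumes "lam \<noteq> 0"
  shows "fps_nth ((deg_exp lam - 1) ^ k) n = fact k * deg_stirling2 lam n k / fact n"
proof -
  let ?c = "\<lambda>k. fact n * fps_nth ((deg_exp lam - 1) ^ k) n / fact k"
  have "is_deg_stirling_row lam n ?c"
    unfolding is_deg_stirling_row_def
  proof (intro conjI allI impI)
    fix y
    have "deg_falling lam y n = fact n * fps_nth (fps_rpow (deg_exp lam) y) n"
      by (simp add: fps_rpow_deg_exp_nth[OF assms])
    also have "\<dots> = (\<Sum>k\<le>n. ?c k * falling y k)"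
      by (simp add: fps_rpow_def fps_compose_nth atLeast0AtMost gchoose_eq_falling
          sum_distrib_left mult_ac)
    finally show "deg_falling lam y n = (\<Sum>k\<le>n. ?c k * falling y k)" .
  next
    fix k assume "k > n"
    then show "?c k = 0"
      using startsby_zero_power_prefix[of "deg_exp lam - 1" k] by (simp add: deg_exp_nth_0)
  qed
  then have "?c = deg_stirling2 lam n"
    by (rule is_deg_stirling_row_unique) (rule is_deg_stirling_row_deg_stirling2)
  then have "deg_stirling2 lam n k = ?c k"
    by (rule fun_cong[OF sym])
  then show ?thesis
    by simp
qed

text \<open>
  The generating function is the negative binomial series composed with \<open>e\<^sub>\<lambda>(t) - 1\<close>, since inversion and
  binomial powers commute with substituting a series that has no constant term.
\<close>

lemma deg_fubini_eq_sum:
  assumes "lam \<noteq> 0"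
  shows "deg_fubini lam a n x = (\<Sum>k\<le>n. pochhammer a k * deg_stirling2 lam n k * x ^ k)"
proof -
  define w where "w = deg_exp lam - 1"
  define p :: "real fps" where "p = 1 - fps_const x * fps_X"
  have w0: "fps_nth w 0 = 0"
    by (simp add: w_def deg_exp_nth_0)
  have p0: "fps_nth p 0 = 1"
    by (simp add: p_def)
  have "p oo w = 1 - fps_const x * w"
    using w0 by (simp add: p_def fps_compose_sub_distrib fps_compose_mult_distrib)
  then have "inverse (1 - fps_const x * w) - 1 = (inverse p - 1) oo w"
    using fps_inverse_compose[OF w0, of p] p0 by (simp add: fps_compose_sub_distrib)
  then have "fps_rpow (inverse (1 - fps_const x * w)) a = fps_rpow (inverse p) a oo w"
    using p0 by (simp add: fps_rpow_def fps_compose_assoc w0)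
  then have "deg_fubini lam a n x
      = (\<Sum>k\<le>n. fact n * (pochhammer a k * x ^ k / fact k * fps_nth (w ^ k) n))"
    by (simp add: deg_fubini_def w_def[symmetric] fps_compose_nth p_def
        fps_rpow_geometric_nth sum_distrib_left atLeast0AtMost)
  also have "\<dots> = (\<Sum>k\<le>n. pochhammer a k * deg_stirling2 lam n k * x ^ k)"
    by (simp add: w_def deg_stirling2_egf[OF assms] mult_ac)
  finally show ?thesis .
qed

theorem theorem3:
  fixes lam x :: real and n :: nat
  assumes "lam \<noteq> 0"
  shows "deg_fubini lam (1 - lam) n x =
    (\<Sum>k\<le>n. pochhammer (1 - lam) k * deg_stirling2 lam n k * x ^ k)"
  using assms by (rule deg_fubini_eq_sum)

end
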